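(* Let $k$ be a field. Any $3$-dimensional metabelian Leibniz algebra over $k$ is isomorphic to $k^3_0$, to $k^3_{(A,B,\gamma)}$ for some $(A,B,\gamma)\in\mathcal{T}(2)$, or to one of the Leibniz algebras $k^{3,1}_{(\Lambda_1,\Lambda_2)}$, $k^{3,2}_{\Lambda_2}$, $k^{3,3}_{(a,b,c,d)}$, $k^{3,4}_{\lambda_2}$, $k^{3,5}_{\lambda_1}$, $k^{3,6}_{(\lambda_1,\lambda_2)}$ (of the six families defined in the context).
   Context: All vector spaces are over an arbitrary field $k$; $k^* = k\setminus\{0\}$. A Leibniz algebra is a vector space with a bilinear bracket satisfying $[x,[y,z]] = [[x,y],z] - [[x,z],y]$. It is abelian if its bracket is zero; $k^3_0$ is $k^3$ with the zero bracket. A Leibniz algebra $\mathfrak{E}$ is metabelian if it is an extension of an abelian Leibniz algebra by another abelian Leibniz algebra, i.e. there is an exact sequence of Leibniz algebras $0\to\mathfrak{g}\to\mathfrak{E}\to\mathfrak{L}\to 0$ with $\mathfrak{g}$ and $\mathfrak{L}$ abelian. $\mathcal{T}(2)$ is the set of triples $(A,B,\gamma)\in\mathrm{M}_2(k)\times\mathrm{M}_2(k)\times k^2$ with $AB=BA=-B^2$ and $B\gamma=0$. For $(A=(a_{ij}),B=(b_{ij}),\gamma=(\gamma_i))\in\mathcal{T}(2)$, $k^3_{(A,B,\gamma)}$ is the Leibniz algebra with basis $\{E_1,E_2,E_3\}$ and bracket $\{E_i,E_3\}=\sum_{j=1}^2 a_{ji}E_j$, $\{E_3,E_i\}=\sum_{j=1}^2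 b_{ji}E_j$ for $i=1,2$, $\{E_3,E_3\}=\sum_{j=1}^2\gamma_jE_j$, other brackets of basis elements being zero. The six families have basis $\{f_1,f_2,f_3\}$ and the following brackets (unlisted brackets of basis elements are zero): - $k^{3,1}_{(\Lambda_1,\Lambda_2)}$, $(\Lambda_1,\Lambda_2)\in k^*\times k$: $\{f_1,f_3\}=-\{f_3,f_1\}=\Lambda_1f_3$, $\{f_2,f_3\}=-\{f_3,f_2\}=\Lambda_2f_3$; - $k^{3,2}_{\Lambda_2}$, $\Lambda_2\in k^*$: $\{f_2,f_3\}=-\{f_3,f_2\}=\Lambda_2f_3$; - $k^{3,3}_{(a,b,c,d)}$, $(a,b,c,d)\in k^4$: $\{f_1,f_1\}=af_3$, $\{f_1,f_2\}=bf_3$, $\{f_2,f_1\}=cf_3$, $\{f_2,f_2\}=df_3$; - $k^{3,4}_{\lambda_2}$, $\lambda_2\in k^*$: $\{f_3,f_2\}=\lambda_2f_3$; - $k^{3,5}_{\lambda_1}$, $\lambda_1\in k^*$: $\{f_3,f_1\}=\lambda_1f_3$; - $k^{3,6}_{(\lambda_1,\lambda_2)}$, $(\lambda_1,\lambda_2)\in k^*\times k^*$: $\{f_3,f_1\}=\lambda_1f_3$, $\{f_3,f_2\}=\lambda_2f_3$. *)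

theory Defs
  imports "HOL-Analysis.Cartesian_Space" "HOL-Library.Numeral_Type"
begin

(* Right Leibniz algebras. The underlying vector space is a whole type. *)
locale leibniz_algebra = vector_space scale
  for scale :: "'k::field \<Rightarrow> 'a::ab_group_add \<Rightarrow> 'a" +
  fixes bracket :: "'a \<Rightarrow> 'a \<Rightarrow> 'a"
  assumes linear_bracket_right: "Vector_Spaces.linear scale scale (\<lambda>y. bracket x y)"
    and linear_bracket_left: "Vector_Spaces.linear scale scale (\<lambda>x. bracket x y)"
    and leibniz_identity:
      "bracket x (bracket y z) = bracket (bracket x y) z - bracket (bracket x z) y"

definition abelian_bracket :: "('a::ab_group_add \<Rightarrow> 'a \<Rightarrow> 'a) \<Rightarrow> bool" where
  "abelian_bracket bracket \<longleftrightarrow> (\<forall>x y. bracket x y = 0)"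

definition leibniz_hom ::
  "('k::field \<Rightarrow> 'a::ab_group_add \<Rightarrow> 'a) \<Rightarrow> ('a \<Rightarrow> 'a \<Rightarrow> 'a) \<Rightarrow>
   ('k \<Rightarrow> 'b::ab_group_add \<Rightarrow> 'b) \<Rightarrow> ('b \<Rightarrow> 'b \<Rightarrow> 'b) \<Rightarrow> ('a \<Rightarrow> 'b) \<Rightarrow> bool" where
  "leibniz_hom s1 b1 s2 b2 f \<longleftrightarrow>
     Vector_Spaces.linear s1 s2 f \<and> (\<forall>x y. f (b1 x y) = b2 (f x) (f y))"

definition leibniz_isomorphic ::
  "('k::field \<Rightarrow> 'a::ab_group_add \<Rightarrow> 'a) \<Rightarrow> ('a \<Rightarrow> 'a \<Rightarrow> 'a) \<Rightarrow>
   ('k \<Rightarrow> 'b::ab_group_add \<Rightarrow> 'b) \<Rightarrow> ('b \<Rightarrow> 'b \<Rightarrow> 'b) \<Rightarrow> bool" where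
  "leibniz_isomorphic s1 b1 s2 b2 \<longleftrightarrow> (\<exists>f. leibniz_hom s1 b1 s2 b2 f \<and> bij f)"

(* Exactness of 0 --> g --i--> E --p--> l --> 0. *)
definition leibniz_short_exact ::
  "('k::field \<Rightarrow> 'g::ab_group_add \<Rightarrow> 'g) \<Rightarrow> ('g \<Rightarrow> 'g \<Rightarrow> 'g) \<Rightarrow>
   ('k \<Rightarrow> 'a::ab_group_add \<Rightarrow> 'a) \<Rightarrow> ('a \<Rightarrow> 'a \<Rightarrow> 'a) \<Rightarrow>
   ('k \<Rightarrow> 'l::ab_group_add \<Rightarrow> 'l) \<Rightarrow> ('l \<Rightarrow> 'l \<Rightarrow> 'l) \<Rightarrow>
   ('g \<Rightarrow> 'a) \<Rightarrow> ('a \<Rightarrow> 'l) \<Rightarrow> bool" where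
  "leibniz_short_exact sg bg s b sl bl i p \<longleftrightarrow>
     leibniz_hom sg bg s b i \<and> leibniz_hom s b sl bl p \<and>
     inj i \<and> range i = {x. p x = 0} \<and> surj p"

(* HOL cannot quantify existentially over types, so the types of the kernel and of the quotient
   are parameters. When they are free type variables in a hypothesis, as in
   "metabelian TYPE('g) TYPE('l) s b ==> ...", that hypothesis covers all possible extensions. *)
definition metabelian ::
  "'g::ab_group_add itself \<Rightarrow> 'l::ab_group_add itself \<Rightarrow>
   ('k::field \<Rightarrow> 'a::ab_group_add \<Rightarrow> 'a) \<Rightarrow> ('a \<Rightarrow> 'a \<Rightarrow> 'a) \<Rightarrow> bool" where
  "metabelian _ _ s b \<longleftrightarrow>
     (\<exists>(sg :: 'k \<Rightarrow> 'g \<Rightarrow> 'g) bg (sl :: 'k \<Rightarrow> 'l \<Rightarrow> 'l) bl i p.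
        leibniz_algebra sg bg \<and> abelian_bracket bg \<and>
        leibniz_algebra sl bl \<and> abelian_bracket bl \<and>
        leibniz_short_exact sg bg s b sl bl i p)"

abbreviation basis3 :: "3 \<Rightarrow> 'k::field ^ 3" where
  "basis3 i \<equiv> axis i 1"

(* The bilinear map on k^3 whose value at the basis vectors (basis3 i, basis3 j) is c (i, j).
   In type 3 the three indices are 1, 2 and 3 (and 3 = 0). *)
definition bracket_of_table ::
  "(3 \<times> 3 \<Rightarrow> 'k::field ^ 3) \<Rightarrow> 'k ^ 3 \<Rightarrow> 'k ^ 3 \<Rightarrow> 'k ^ 3" where
  "bracket_of_table c x y = (\<Sum>i\<in>UNIV. \<Sum>j\<in>UNIV. (x $ i * y $ j) *s c (i, j))"

definition k3_0 :: "'k::field ^ 3 \<Rightarrow> 'k ^ 3 \<Rightarrow> 'k ^ 3" where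
  "k3_0 = (\<lambda>_ _. 0)"

definition T2 :: "(('k::field ^ 2 ^ 2) \<times> ('k ^ 2 ^ 2) \<times> ('k ^ 2)) set" where
  "T2 = {(A, B, \<gamma>). A ** B = B ** A \<and> B ** A = - (B ** B) \<and> B *v \<gamma> = 0}"

(* A $ i $ j is the (i, j) entry; column i of A (resp. B) holds the coordinates of
   {basis3 i, basis3 3} (resp. {basis3 3, basis3 i}) with respect to basis3 1, basis3 2. *)
definition k3_mat ::
  "'k::field ^ 2 ^ 2 \<Rightarrow> 'k ^ 2 ^ 2 \<Rightarrow> 'k ^ 2 \<Rightarrow> 'k ^ 3 \<Rightarrow> 'k ^ 3 \<Rightarrow> 'k ^ 3" where
  "k3_mat A B \<gamma> = bracket_of_table ((\<lambda>_. 0)(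
     (1, 3) := A $ 1 $ 1 *s basis3 1 + A $ 2 $ 1 *s basis3 2,
     (2, 3) := A $ 1 $ 2 *s basis3 1 + A $ 2 $ 2 *s basis3 2,
     (3, 1) := B $ 1 $ 1 *s basis3 1 + B $ 2 $ 1 *s basis3 2,
     (3, 2) := B $ 1 $ 2 *s basis3 1 + B $ 2 $ 2 *s basis3 2,
     (3, 3) := \<gamma> $ 1 *s basis3 1 + \<gamma> $ 2 *s basis3 2))"

definition k3_1 :: "'k::field \<Rightarrow> 'k \<Rightarrow> 'k ^ 3 \<Rightarrow> 'k ^ 3 \<Rightarrow> 'k ^ 3" where
  "k3_1 \<Lambda>1 \<Lambda>2 = bracket_of_table ((\<lambda>_. 0)(
     (1, 3) := \<Lambda>1 *s basis3 3, (3, 1) := - (\<Lambda>1 *s basis3 3),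
     (2, 3) := \<Lambda>2 *s basis3 3, (3, 2) := - (\<Lambda>2 *s basis3 3)))"

definition k3_2 :: "'k::field \<Rightarrow> 'k ^ 3 \<Rightarrow> 'k ^ 3 \<Rightarrow> 'k ^ 3" where
  "k3_2 \<Lambda>2 = bracket_of_table ((\<lambda>_. 0)(
     (2, 3) := \<Lambda>2 *s basis3 3, (3, 2) := - (\<Lambda>2 *s basis3 3)))"

definition k3_3 :: "'k::field \<Rightarrow> 'k \<Rightarrow> 'k \<Rightarrow> 'k \<Rightarrow> 'k ^ 3 \<Rightarrow> 'k ^ 3 \<Rightarrow> 'k ^ 3" where
  "k3_3 a b c d = bracket_of_table ((\<lambda>_. 0)(
     (1, 1) := a *s basis3 3, (1, 2) := b *s basis3 3,
     (2, 1) := c *s basis3 3, (2, 2) := d *s basis3 3))"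

definition k3_4 :: "'k::field \<Rightarrow> 'k ^ 3 \<Rightarrow> 'k ^ 3 \<Rightarrow> 'k ^ 3" where
  "k3_4 lam2 = bracket_of_table ((\<lambda>_. 0)((3, 2) := lam2 *s basis3 3))"

definition k3_5 :: "'k::field \<Rightarrow> 'k ^ 3 \<Rightarrow> 'k ^ 3 \<Rightarrow> 'k ^ 3" where
  "k3_5 lam1 = bracket_of_table ((\<lambda>_. 0)((3, 1) := lam1 *s basis3 3))"

definition k3_6 :: "'k::field \<Rightarrow> 'k \<Rightarrow> 'k ^ 3 \<Rightarrow> 'k ^ 3 \<Rightarrow> 'k ^ 3" where
  "k3_6 lam1 lam2 = bracket_of_table ((\<lambda>_. 0)(
     (3, 1) := lam1 *s basis3 3, (3, 2) := lam2 *s basis3 3))"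

lemma bracket_of_table_basis3: "bracket_of_table c (basis3 i) (basis3 j) = c (i, j)"
proof -
  have "bracket_of_table c (basis3 i) (basis3 j) =
      (\<Sum>i'\<in>UNIV. \<Sum>j'\<in>UNIV. if j' = j then (if i' = i then c (i', j') else 0) else 0)"
    unfolding bracket_of_table_def by (intro sum.cong refl) (auto simp: axis_def)
  also have "\<dots> = c (i, j)"
    by (simp add: sum.delta)
  finally show ?thesis .
qed

lemma linear_bracket_of_table:
  "Vector_Spaces.linear (*s) (*s) (\<lambda>y. bracket_of_table c x y)"
  "Vector_Spaces.linear (*s) (*s) (\<lambda>x. bracket_of_table c x y)"
  by (auto intro!: Vector_Spaces.linear.intro module_hom.intro module_hom_axioms.intro
        vec.module_axioms vec.vector_space_axioms
      simp: bracket_of_table_def algebra_simps sum.distrib vec_eq_iff sum_distrib_left)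

lemma leibniz_algebra_of_table:
  assumes "\<And>x y z. bracket_of_table c x (bracket_of_table c y z) =
    bracket_of_table c (bracket_of_table c x y) z - bracket_of_table c (bracket_of_table c x z) y"
  shows "leibniz_algebra (*s) (bracket_of_table c)"
  using assms by (intro leibniz_algebra.intro leibniz_algebra_axioms.intro
    vec.vector_space_axioms linear_bracket_of_table)

lemma leibniz_identity_row:
  fixes a1 a2 b1 b2 :: "'k::comm_ring_1"
  assumes AB: "a1 * b11 + a2 * b21 = - (b1 * b11 + b2 * b21)"
      "a1 * b12 + a2 * b22 = - (b1 * b12 + b2 * b22)"
    and BA: "b1 * a11 + b2 * a21 = - (b1 * b11 + b2 * b21)"
      "b1 * a12 + b2 * a22 = - (b1 * b12 + b2 * b22)"
    and Bg: "b1 * g1 + b2 * g2 = 0"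
  shows "0 * u + x3 *
      (b1 * (z3 * (a11 * y1 + a12 * y2) + y3 * (b11 * z1 + b12 * z2 + g1 * z3)) +
       b2 * (z3 * (a21 * y1 + a22 * y2) + y3 * (b21 * z1 + b22 * z2 + g2 * z3)) + g * 0) =
    z3 *
      (a1 * (y3 * (a11 * x1 + a12 * x2) + x3 * (b11 * y1 + b12 * y2 + g1 * y3)) +
       a2 * (y3 * (a21 * x1 + a22 * x2) + x3 * (b21 * y1 + b22 * y2 + g2 * y3))) + 0 * v -
    (y3 *
      (a1 * (z3 * (a11 * x1 + a12 * x2) + x3 * (b11 * z1 + b12 * z2 + g1 * z3)) +
       a2 * (z3 * (a21 * x1 + a22 * x2) + x3 * (b21 * z1 + b22 * z2 + g2 * z3))) + 0 * w)"
    (is "?L = ?R")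
proof -
  have "?L - ?R =
     x3 * z3 * (((b1 * a11 + b2 * a21) - (a1 * b11 + a2 * b21)) * y1 +
                ((b1 * a12 + b2 * a22) - (a1 * b12 + a2 * b22)) * y2) +
     x3 * y3 * (((b1 * b11 + b2 * b21) + (a1 * b11 + a2 * b21)) * z1 +
                ((b1 * b12 + b2 * b22) + (a1 * b12 + a2 * b22)) * z2) +
     x3 * y3 * z3 * (b1 * g1 + b2 * g2)"
    by (simp add: algebra_simps)
  also have "\<dots> = 0"
    unfolding AB BA Bg by simp
  finally show ?thesis by simp
qed

lemma leibniz_algebra_k3_mat:
  assumes "(A, B, \<gamma>) \<in> T2"
  shows "leibniz_algebra (*s) (k3_mat A B \<gamma>)"
proof -
  have comp: "k3_mat A B \<gamma> x y $ 1 =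
        y $ 3 * (A $ 1 $ 1 * x $ 1 + A $ 1 $ 2 * x $ 2) +
        x $ 3 * (B $ 1 $ 1 * y $ 1 + B $ 1 $ 2 * y $ 2 + \<gamma> $ 1 * y $ 3)"
      "k3_mat A B \<gamma> x y $ 2 =
        y $ 3 * (A $ 2 $ 1 * x $ 1 + A $ 2 $ 2 * x $ 2) +
        x $ 3 * (B $ 2 $ 1 * y $ 1 + B $ 2 $ 2 * y $ 2 + \<gamma> $ 2 * y $ 3)"
      "k3_mat A B \<gamma> x y $ 3 = 0" for x y
    by (simp_all add: k3_mat_def bracket_of_table_def sum_3 axis_def algebra_simps)
  from assms have eqs:
    "A$1$1 * B$1$1 + A$1$2 * B$2$1 = - (B$1$1 * B$1$1 + B$1$2 * B$2$1)"
    "A$1$1 * B$1$2 + A$1$2 * B$2$2 = - (B$1$1 * B$1$2 + B$1$2 * B$2$2)"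
    "A$2$1 * B$1$1 + A$2$2 * B$2$1 = - (B$2$1 * B$1$1 + B$2$2 * B$2$1)"
    "A$2$1 * B$1$2 + A$2$2 * B$2$2 = - (B$2$1 * B$1$2 + B$2$2 * B$2$2)"
    "B$1$1 * A$1$1 + B$1$2 * A$2$1 = - (B$1$1 * B$1$1 + B$1$2 * B$2$1)"
    "B$1$1 * A$1$2 + B$1$2 * A$2$2 = - (B$1$1 * B$1$2 + B$1$2 * B$2$2)"
    "B$2$1 * A$1$1 + B$2$2 * A$2$1 = - (B$2$1 * B$1$1 + B$2$2 * B$2$1)"
    "B$2$1 * A$1$2 + B$2$2 * A$2$2 = - (B$2$1 * B$1$2 + B$2$2 * B$2$2)"
    "B$1$1 * \<gamma>$1 + B$1$2 * \<gamma>$2 = 0"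
    "B$2$1 * \<gamma>$1 + B$2$2 * \<gamma>$2 = 0"
  proof -
    have "A ** B = - (B ** B)" "B ** A = - (B ** B)" "B *v \<gamma> = 0"
      using assms by (auto simp: T2_def)
    then have "(A ** B) $ i $ j = (- (B ** B)) $ i $ j"
      "(B ** A) $ i $ j = (- (B ** B)) $ i $ j" "(B *v \<gamma>) $ i = 0" for i j
      by simp_all
    then show
      "A$1$1 * B$1$1 + A$1$2 * B$2$1 = - (B$1$1 * B$1$1 + B$1$2 * B$2$1)"
      "A$1$1 * B$1$2 + A$1$2 * B$2$2 = - (B$1$1 * B$1$2 + B$1$2 * B$2$2)"
      "A$2$1 * B$1$1 + A$2$2 * B$2$1 = - (B$2$1 * B$1$1 + B$2$2 * B$2$1)"
      "A$2$1 * B$1$2 + A$2$2 * B$2$2 = - (B$2$1 * B$1$2 + B$2$2 * B$2$2)"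
      "B$1$1 * A$1$1 + B$1$2 * A$2$1 = - (B$1$1 * B$1$1 + B$1$2 * B$2$1)"
      "B$1$1 * A$1$2 + B$1$2 * A$2$2 = - (B$1$1 * B$1$2 + B$1$2 * B$2$2)"
      "B$2$1 * A$1$1 + B$2$2 * A$2$1 = - (B$2$1 * B$1$1 + B$2$2 * B$2$1)"
      "B$2$1 * A$1$2 + B$2$2 * A$2$2 = - (B$2$1 * B$1$2 + B$2$2 * B$2$2)"
      "B$1$1 * \<gamma>$1 + B$1$2 * \<gamma>$2 = 0"
      "B$2$1 * \<gamma>$1 + B$2$2 * \<gamma>$2 = 0"
      unfolding vector_uminus_component
      by (simp_all only: matrix_matrix_mult_def matrix_vector_mult_def vec_lambda_beta sum_2)
  qed
  show ?thesis
    unfolding k3_mat_def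
  proof (rule leibniz_algebra_of_table, fold k3_mat_def)
    fix x y z :: "'a ^ 3"
    show "k3_mat A B \<gamma> x (k3_mat A B \<gamma> y z) =
      k3_mat A B \<gamma> (k3_mat A B \<gamma> x y) z - k3_mat A B \<gamma> (k3_mat A B \<gamma> x z) y"
      unfolding vec_eq_iff forall_3 vector_minus_component comp
      by (intro conjI leibniz_identity_row eqs) simp
  qed
qed

lemma leibniz_algebra_families:
  "leibniz_algebra (*s) (k3_1 a b)" "leibniz_algebra (*s) (k3_2 a)"
  "leibniz_algebra (*s) (k3_3 a b c d)" "leibniz_algebra (*s) (k3_4 a)"
  "leibniz_algebra (*s) (k3_5 a)" "leibniz_algebra (*s) (k3_6 a b)"
  unfolding k3_1_def k3_2_def k3_3_def k3_4_def k3_5_def k3_6_def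
  by (rule leibniz_algebra_of_table;
      simp add: bracket_of_table_def sum_3 vec_eq_iff forall_3 axis_def algebra_simps)+

end

theory Submission
  imports Defs
begin

text \<open>The kernel \<open>N\<close> of the extension is a subspace with \<open>[E, E] \<subseteq> N\<close> and \<open>[N, N] = 0\<close>, so in a basis
adapted to \<open>N\<close> the bracket is given by few structure constants. If \<open>N\<close> is trivial or everything, the
bracket vanishes. If \<open>dim N = 2\<close>, the Leibniz identity on the basis is the definition of \<open>T2\<close>. If \<open>N\<close>
is the line through \<open>e\<^sub>3\<close> and \<open>[e\<^sub>i, e\<^sub>j] = t\<^sub>i\<^sub>j e\<^sub>3\<close>, the Leibniz identity reads
\<open>t\<^sub>j\<^sub>k t\<^sub>i\<^sub>3 = t\<^sub>i\<^sub>j t\<^sub>3\<^sub>k - t\<^sub>i\<^sub>k t\<^sub>3\<^sub>j\<close>. Unless all \<open>t\<^sub>i\<^sub>3\<close> and \<open>t\<^sub>3\<^sub>i\<close> vanish, which is the family \<open>k3_3\<close>, it allows us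
to annihilate the \<open>t\<^sub>i\<^sub>j\<close> with \<open>i, j \<le> 2\<close> by a shear \<open>e\<^sub>i \<mapsto> e\<^sub>i + s\<^sub>i e\<^sub>3\<close>. What remains is antisymmetric
if some \<open>t\<^sub>i\<^sub>3 \<noteq> 0\<close> (\<open>k3_1\<close>, \<open>k3_2\<close>) and only involves the \<open>t\<^sub>3\<^sub>j\<close> otherwise (\<open>k3_4\<close>, \<open>k3_5\<close>, \<open>k3_6\<close>).\<close>

section \<open>Linear algebra: coordinates, bases adapted to a subspace, shears\<close>

lemma linear_simps:
  assumes "Vector_Spaces.linear s1 s2 f"
  shows "f (x + y) = f x + f y" "f (s1 a x) = s2 a (f x)" "f 0 = 0"
  using assms by (auto simp: linear_iff_module_hom module_hom.add module_hom.scale module_hom.zero)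

text \<open>The coordinate map of the family \<open>e\<close>: "\<open>e\<close> is a basis" is
  expressed throughout as \<open>bij (comb s e)\<close>.\<close>

definition comb :: "('k \<Rightarrow> 'b \<Rightarrow> 'b) \<Rightarrow> ('n::finite \<Rightarrow> 'b) \<Rightarrow> 'k ^ 'n \<Rightarrow> 'b::ab_group_add" where
  "comb s e v = (\<Sum>i\<in>UNIV. s (v $ i) (e i))"

context vector_space
begin

(* Inside this locale the infix *s denotes scale, hence the prefix form vector_scalar_mult. *)

lemma comb_add: "comb scale e (v + w) = comb scale e v + comb scale e w"
  by (simp add: comb_def scale_left_distrib sum.distrib)

lemma comb_scale: "comb scale e (vector_scalar_mult a v) = scale a (comb scale e v)"
  by (simp add: comb_def scale_sum_right)

lemma comb_zero: "comb scale e 0 = 0"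
  by (simp add: comb_def)

lemma comb_sum: "comb scale e (\<Sum>i\<in>I. v i) = (\<Sum>i\<in>I. comb scale e (v i))"
  by (induction I rule: infinite_finite_induct) (simp_all add: comb_zero comb_add)

lemma comb_axis: "comb scale e (axis i 1) = e i"
proof -
  have "comb scale e (axis i 1) = (\<Sum>j\<in>UNIV. if j = i then e j else 0)"
    unfolding comb_def by (intro sum.cong) (auto simp: axis_def)
  then show ?thesis by simp
qed

lemma comb_in_span: "comb scale e v \<in> span (range e)"
  unfolding comb_def by (intro span_sum span_scale span_base) simp

text \<open>An infinite-dimensional space has \<open>dim\<close> 0, so
  \<open>dim UNIV \<noteq> 0\<close> is how finiteness enters. A basis of \<open>N\<close> then
  extends to a finite basis of the whole space.\<close>

lemma dim_le_of_subspace: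
  assumes "subspace N" and "dim UNIV \<noteq> 0"
  shows "dim N \<le> dim UNIV"
proof -
  obtain B where B: "B \<subseteq> N" "independent B" "N \<subseteq> span B"
    using maximal_independent_subset[of N] by metis
  obtain C where C: "B \<subseteq> C" "independent C" "UNIV \<subseteq> span C"
    using maximal_independent_subset_extend[of B UNIV] B(2) by (metis subset_UNIV)
  have "card C = dim UNIV" "card B = dim N"
    using basis_card_eq_dim[of C UNIV] basis_card_eq_dim[of B N] B C by auto
  moreover have "finite C"
    using assms(2) calculation(1) by (metis card.infinite)
  ultimately show ?thesis
    using card_mono[of C B] C(1) by simp
qed

text \<open>Extend a basis \<open>B\<close> of \<open>N\<close> to a basis \<open>C\<close> of the
  space, then label \<open>B\<close> by \<open>I\<close> and \<open>C - B\<close> by the complement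
  of \<open>I\<close>. Leaving \<open>I\<close> free allows each case to choose which basis vectors
  span \<open>N\<close>.\<close>

lemma adapted_basis:
  fixes I :: "'n::finite set"
  assumes N: "subspace N" and dim: "dim UNIV = CARD('n)" and I: "card I = dim N"
  shows "\<exists>e :: 'n \<Rightarrow> 'b. bij (comb scale e) \<and> span (e ` I) = N"
proof -
  obtain B where B: "B \<subseteq> N" "independent B" "N \<subseteq> span B"
    using maximal_independent_subset[of N] by metis
  obtain C where C: "B \<subseteq> C" "independent C" "UNIV \<subseteq> span C"
    using maximal_independent_subset_extend[of B UNIV] B(2) by (metis subset_UNIV)
  have cards: "card C = CARD('n)" "card B = card I"
    using basis_card_eq_dim[of C UNIV] basis_card_eq_dim[of B N] B C dim I by auto
  have fin: "finite C"
    using cards(1) by (metis card.infinite zero_less_card_finite less_numeral_extra(3))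
  then have finB: "finite B"
    using C(1) finite_subset by blast
  obtain f where f: "bij_betw f I B"
    using finite_same_card_bij[of I B] finB cards(2) by auto
  have "card (- I) = card (C - B)"
    using cards C(1) finB by (simp add: card_Diff_subset Compl_eq_Diff_UNIV)
  then obtain g where g: "bij_betw g (- I) (C - B)"
    using finite_same_card_bij[of "- I" "C - B"] fin by auto
  define e where "e = (\<lambda>i. if i \<in> I then f i else g i)"
  have eI: "bij_betw e I B"
    using f by (rule bij_betw_cong[THEN iffD1, rotated]) (simp add: e_def)
  have eJ: "bij_betw e (- I) (C - B)"
    using g by (rule bij_betw_cong[THEN iffD1, rotated]) (simp add: e_def)
  have e: "bij_betw e UNIV C"
    using bij_betw_combine[OF eI eJ] C(1) by (simp add: Un_absorb1)
  then have inj: "inj e" and ran: "range e = C"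
    by (auto simp: bij_betw_def)
  have comb_eq: "comb scale e v = (\<Sum>c\<in>C. scale (v $ inv e c) c)" for v
    unfolding comb_def using inj ran by (subst sum.reindex_bij_betw[OF e, symmetric]) simp
  have "inj (comb scale e)"
  proof (rule injI)
    fix v w assume "comb scale e v = comb scale e w"
    then have "(\<Sum>c\<in>C. scale (v $ inv e c - w $ inv e c) c) = 0"
      by (simp add: comb_eq scale_left_diff_distrib sum_subtractf)
    then have "v $ inv e c - w $ inv e c = 0" if "c \<in> C" for c
      using independentD[OF C(2) fin subset_refl, of "\<lambda>c. v $ inv e c - w $ inv e c"] that
      by simp
    then have "v $ i = w $ i" for i
      using inj ran by (metis inv_f_f rangeI right_minus_eq)
    then show "v = w"
      by (simp add: vec_eq_iff)
  qed
  moreover have "surj (comb scale e)"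
  proof (rule surjI)
    fix x
    have "x \<in> span C" using C(3) by auto
    then obtain u where u: "x = (\<Sum>c\<in>C. scale (u c) c)"
      using span_finite[OF fin] by auto
    have "comb scale e (\<chi> i. u (e i)) = x"
      unfolding comb_def u by (subst sum.reindex_bij_betw[OF e, symmetric]) simp
    then show "comb scale e (inv (comb scale e) x) = x"
      by (metis f_inv_into_f rangeI)
  qed
  moreover have "e ` I = B"
    using eI by (simp add: bij_betw_def)
  moreover have "span B = N"
    using B N by (metis span_minimal subset_antisym)
  ultimately show ?thesis
    by (auto simp: bij_def)
qed

text \<open>The new coordinate map is the old one after the transvection \<open>T\<close>, which
  adds \<open>l v\<close> times the \<open>m\<close>-th unit vector. As \<open>s m = 0\<close>, the
  functional \<open>l\<close> vanishes on that vector, so \<open>T\<close> preserves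
  \<open>l\<close> and is inverted by reversing the sign of \<open>l\<close>.\<close>

lemma bij_comb_shear:
  fixes e :: "'n::finite \<Rightarrow> 'b"
  assumes "bij (comb scale e)" and "s m = 0"
  shows "bij (comb scale (\<lambda>i. e i + scale (s i) (e m)))"
proof -
  define l where "l v = (\<Sum>i\<in>UNIV. v $ i * s i)" for v :: "'a ^ 'n"
  have l_shift: "l (v + vector_scalar_mult a (axis m 1)) = l v" for v a
  proof -
    have "(v + vector_scalar_mult a (axis m 1)) $ i * s i = v $ i * s i" for i
      using assms(2) by (cases "i = m") (auto simp: axis_def)
    then show ?thesis unfolding l_def by (simp only:)
  qed
  define T where "T v = v + vector_scalar_mult (l v) (axis m 1)" for v
  have "comb scale (\<lambda>i. e i + scale (s i) (e m)) = comb scale e \<circ> T"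
    by (rule ext) (simp add: T_def comb_add comb_scale comb_axis comb_def[of _ "\<lambda>i. e i + _ i"]
        scale_right_distrib sum.distrib l_def scale_sum_left, simp add: comb_def)
  moreover have "bij T"
  proof (rule bij_betw_byWitness[where f' = "\<lambda>v. v + vector_scalar_mult (- l v) (axis m 1)"])
    show "\<forall>v\<in>UNIV. T v + vector_scalar_mult (- l (T v)) (axis m 1) = v"
      unfolding T_def l_shift by (simp add: vec_eq_iff)
    show "\<forall>v\<in>UNIV. T (v + vector_scalar_mult (- l v) (axis m 1)) = v"
      unfolding T_def l_shift by (simp add: vec_eq_iff)
  qed auto
  ultimately show ?thesis
    using assms(1) by (simp add: bij_comp)
qed

end

section \<open>Brackets in coordinates, and kernels of dimension two and one\<close>

context leibniz_algebra
begin

lemma bracket_simps: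
  "bracket (x + y) z = bracket x z + bracket y z"
  "bracket x (y + z) = bracket x y + bracket x z"
  "bracket (scale a x) y = scale a (bracket x y)"
  "bracket x (scale a y) = scale a (bracket x y)"
  "bracket 0 x = 0" "bracket x 0 = 0"
  using linear_simps[OF linear_bracket_left] linear_simps[OF linear_bracket_right] by blast+

lemma bracket_sum:
  "bracket (\<Sum>i\<in>I. f i) y = (\<Sum>i\<in>I. bracket (f i) y)"
  "bracket x (\<Sum>i\<in>I. f i) = (\<Sum>i\<in>I. bracket x (f i))"
  by (induction I rule: infinite_finite_induct) (simp_all add: bracket_simps)

text \<open>This trades the extension, with its auxiliary types, for a subspace. \<open>N\<close> is
  the kernel of \<open>p\<close>, which contains all brackets because the quotient is abelian; it is
  also the range of \<open>i\<close>, hence abelian itself.\<close>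

lemma metabelian_subspace:
  assumes "metabelian TYPE('g::ab_group_add) TYPE('l::ab_group_add) scale bracket"
  shows "\<exists>N. subspace N \<and> (\<forall>x y. bracket x y \<in> N) \<and> (\<forall>x\<in>N. \<forall>y\<in>N. bracket x y = 0)"
proof -
  obtain sg :: "'k \<Rightarrow> 'g \<Rightarrow> 'g" and bg and sl :: "'k \<Rightarrow> 'l \<Rightarrow> 'l" and bl i p where
    ab: "abelian_bracket bg" "abelian_bracket bl"
    and ex: "leibniz_short_exact sg bg scale bracket sl bl i p"
    and "leibniz_algebra sl bl"
    using assms unfolding metabelian_def by blast
  interpret l: leibniz_algebra sl bl by fact
  have i: "Vector_Spaces.linear sg scale i" "\<And>x y. i (bg x y) = bracket (i x) (i y)"
    and p: "Vector_Spaces.linear scale sl p" "\<And>x y. p (bracket x y) = bl (p x) (p y)"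
    and ker: "range i = {x. p x = 0}"
    using ex by (auto simp: leibniz_short_exact_def leibniz_hom_def)
  have "subspace {x. p x = 0}"
    by (rule subspaceI) (simp_all add: linear_simps[OF p(1)])
  moreover have "p (bracket x y) = 0" for x y
    using ab(2) by (simp add: p(2) abelian_bracket_def)
  moreover have "bracket x y = 0" if xy: "x \<in> range i" "y \<in> range i" for x y
  proof -
    obtain u v where "x = i u" "y = i v"
      using xy by blast
    then show ?thesis
      using ab(1) by (simp add: i(2)[symmetric] abelian_bracket_def linear_simps(3)[OF i(1)])
  qed
  ultimately show ?thesis
    by (intro exI[of _ "{x. p x = 0}"]) (auto simp: ker)
qed

text \<open>Both brackets are bilinear, so agreement on the basis makes \<open>comb scale e\<close>
  multiplicative; its inverse is the isomorphism. It remains to find, in each case, a basis with the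
  right table.\<close>

lemma isomorphic_bracket_of_table:
  fixes e :: "3 \<Rightarrow> 'a"
  assumes bij: "bij (comb scale e)" and c: "\<And>i j. bracket (e i) (e j) = comb scale e (c (i, j))"
  shows "leibniz_isomorphic scale bracket (*s) (bracket_of_table c)"
proof -
  \<comment> \<open>The left argument is expanded first, so that the double sum comes out in the
    order used by \<open>bracket_of_table\<close>.\<close>
  have hom: "comb scale e (bracket_of_table c v w) = bracket (comb scale e v) (comb scale e w)" for v w
    by (simp add: bracket_of_table_def comb_sum comb_scale c[symmetric])
      (simp add: comb_def bracket_sum(1), simp add: bracket_sum(2) bracket_simps scale_sum_right mult.commute)
  define f where "f = inv (comb scale e)"
  have f: "comb scale e (f x) = x" "f (comb scale e v) = v" for x v
    using bij by (simp_all add: f_def bij_is_surj surj_f_inv_f bij_is_inj)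
  have "f (x + y) = f x + f y" for x y
    by (metis f comb_add)
  moreover have "f (scale a x) = a *s f x" for a x
    by (metis f comb_scale)
  ultimately have "Vector_Spaces.linear scale (*s) f"
    by (intro Vector_Spaces.linear.intro module_hom.intro module_hom_axioms.intro
        vec.module_axioms vec.vector_space_axioms module_axioms vector_space_axioms)
  moreover have "f (bracket x y) = bracket_of_table c (f x) (f y)" for x y
    by (metis f hom)
  moreover have "bij f"
    using bij by (simp add: f_def bij_imp_bij_inv)
  ultimately show ?thesis
    unfolding leibniz_isomorphic_def leibniz_hom_def by blast
qed

lemma isomorphic_k3_0:
  fixes e :: "3 \<Rightarrow> 'a"
  assumes "bij (comb scale e)" and "\<And>x y. bracket x y = 0"
  shows "leibniz_isomorphic scale bracket (*s) k3_0"
proof -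
  have "k3_0 = bracket_of_table (\<lambda>_. 0 :: 'k ^ 3)"
    by (simp add: k3_0_def bracket_of_table_def fun_eq_iff)
  then show ?thesis
    using isomorphic_bracket_of_table[OF assms(1), of "\<lambda>_. 0"] assms(2) by (simp add: comb_zero)
qed

text \<open>\<open>A\<close> and \<open>B\<close> are the matrices of right and left multiplication
  by \<open>e 3\<close> on \<open>N\<close>, and \<gamma> holds the coordinates of the square of
  \<open>e 3\<close>. Comparing coefficients by \<open>unique\<close> turns Leibniz identities into
  matrix equations.\<close>

lemma isomorphic_two_dim_kernel:
  fixes e :: "3 \<Rightarrow> 'a"
  assumes bij: "bij (comb scale e)"
    and mem: "\<And>x y. bracket x y \<in> span (e ` {1, 2})"
    and ab: "\<And>x y. x \<in> span (e ` {1, 2}) \<Longrightarrow> y \<in> span (e ` {1, 2}) \<Longrightarrow> bracket x y = 0"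
  shows "\<exists>A B \<gamma>. (A, B, \<gamma>) \<in> T2 \<and> leibniz_isomorphic scale bracket (*s) (k3_mat A B \<gamma>)"
proof -
  have "\<exists>a b. x = scale a (e 1) + scale b (e 2)" if "x \<in> span (e ` {1, 2})" for x
    using that by (auto simp: span_breakdown_eq algebra_simps)
  then have "\<forall>x y. \<exists>a b. bracket x y = scale a (e 1) + scale b (e 2)"
    using mem by simp
  then obtain p q where pq: "bracket x y = scale (p x y) (e 1) + scale (q x y) (e 2)" for x y
    by metis
  have unique: "a = c \<and> b = d"
    if "scale a (e 1) + scale b (e 2) = scale c (e 1) + scale d (e 2)" for a b c d
  proof -
    have "comb scale e (a *s axis 1 1 + b *s axis 2 1) = comb scale e (c *s axis 1 1 + d *s axis 2 1)"
      using that by (simp add: comb_add comb_scale comb_axis)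
    then have "a *s axis 1 1 + b *s axis 2 1 = (c *s axis 1 1 + d *s axis 2 1 :: 'k ^ 3)"
      using bij by (simp add: bij_is_inj inj_eq)
    then show ?thesis
      by (simp add: vec_eq_iff forall_3 axis_def)
  qed
  have e0: "bracket (e i) (e j) = 0" if "i \<in> {1, 2}" "j \<in> {1, 2}" for i j
    using that by (intro ab span_base) auto
  have e33_0: "bracket (bracket (e 3) (e 3)) (e j) = 0" if "j \<in> {1, 2}" for j
    using that by (intro ab mem span_base) auto
  \<comment> \<open>The row selects the coordinate function \<open>p\<close> or \<open>q\<close>;
    the column, an index of type \<open>2\<close>, is translated into an index of type
    \<open>3\<close>.\<close>
  define A :: "'k ^ 2 ^ 2" where
    "A = (\<chi> i j. (if i = 1 then p else q) (e (if j = 1 then 1 else 2)) (e 3))"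
  define B :: "'k ^ 2 ^ 2" where
    "B = (\<chi> i j. (if i = 1 then p else q) (e 3) (e (if j = 1 then 1 else 2)))"
  define \<gamma> :: "'k ^ 2" where "\<gamma> = (\<chi> i. (if i = 1 then p else q) (e 3) (e 3))"
  have right: "bracket (e 1) (e 3) = scale (A$1$1) (e 1) + scale (A$2$1) (e 2)"
      "bracket (e 2) (e 3) = scale (A$1$2) (e 1) + scale (A$2$2) (e 2)"
    and left: "bracket (e 3) (e 1) = scale (B$1$1) (e 1) + scale (B$2$1) (e 2)"
      "bracket (e 3) (e 2) = scale (B$1$2) (e 1) + scale (B$2$2) (e 2)"
    and sq: "bracket (e 3) (e 3) = scale (\<gamma>$1) (e 1) + scale (\<gamma>$2) (e 2)"
    unfolding A_def B_def \<gamma>_def using pq by simp_all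
  have "leibniz_isomorphic scale bracket (*s) (k3_mat A B \<gamma>)"
    unfolding k3_mat_def
  proof (rule isomorphic_bracket_of_table[OF bij])
    fix i j :: 3
    show "bracket (e i) (e j) = comb scale e (((\<lambda>_. 0)(
     (1, 3) := A $ 1 $ 1 *s basis3 1 + A $ 2 $ 1 *s basis3 2,
     (2, 3) := A $ 1 $ 2 *s basis3 1 + A $ 2 $ 2 *s basis3 2,
     (3, 1) := B $ 1 $ 1 *s basis3 1 + B $ 2 $ 1 *s basis3 2,
     (3, 2) := B $ 1 $ 2 *s basis3 1 + B $ 2 $ 2 *s basis3 2,
     (3, 3) := \<gamma> $ 1 *s basis3 1 + \<gamma> $ 2 *s basis3 2)) (i, j))"
      using exhaust_3[of i] exhaust_3[of j]
      by (auto simp: e0 right left sq comb_add comb_scale comb_axis comb_zero)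
  qed
  moreover have "(A, B, \<gamma>) \<in> T2"
  proof -
    \<comment> \<open>The square of \<open>e 3\<close> lies in \<open>N\<close>, so by
      \<open>e33_0\<close> one term of each identity drops out. What is left says
      \<open>BA = AB\<close> and \<open>BB = -AB\<close> on \<open>e j\<close>.\<close>
    have BA: "bracket (e 3) (bracket (e j) (e 3)) = bracket (bracket (e 3) (e j)) (e 3)"
      and BB: "bracket (e 3) (bracket (e 3) (e j)) = - bracket (bracket (e 3) (e j)) (e 3)"
      if "j \<in> {1, 2}" for j
      using leibniz_identity[of "e 3" "e j" "e 3"] leibniz_identity[of "e 3" "e 3" "e j"]
        e33_0[OF that] by simp_all
    have Bg: "bracket (e 3) (bracket (e 3) (e 3)) = 0"
      using leibniz_identity[of "e 3" "e 3" "e 3"] by simp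
    have L: "bracket (e 3) (scale a (e 1) + scale b (e 2)) =
          scale (B$1$1 * a + B$1$2 * b) (e 1) + scale (B$2$1 * a + B$2$2 * b) (e 2)"
      and R: "bracket (scale a (e 1) + scale b (e 2)) (e 3) =
          scale (A$1$1 * a + A$1$2 * b) (e 1) + scale (A$2$1 * a + A$2$2 * b) (e 2)" for a b
      by (simp_all add: bracket_simps left right algebra_simps)
    have neg: "- (scale a (e 1) + scale b (e 2)) = scale (- a) (e 1) + scale (- b) (e 2)" for a b
      by simp
    have "bracket (e 3) (bracket (e 3) (e 3)) = scale 0 (e 1) + scale 0 (e 2)"
      using Bg by simp
    note \<gamma>_eqs = this[unfolded sq L, THEN unique]
    note AB_eqs = BA[of 1, simplified, unfolded right left L R, THEN unique]
      BA[of 2, simplified, unfolded right left L R, THEN unique]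
    note BB_eqs = BB[of 1, simplified, unfolded left L R neg, THEN unique]
      BB[of 2, simplified, unfolded left L R neg, THEN unique]
    have "B ** A = A ** B" "B ** B = - (A ** B)" "B *v \<gamma> = 0"
      using \<gamma>_eqs AB_eqs BB_eqs
      by (simp_all add: vec_eq_iff forall_2 matrix_matrix_mult_def matrix_vector_mult_def sum_2)
    then show ?thesis
      by (simp add: T2_def)
  qed
  ultimately show ?thesis by blast
qed

lemma isomorphic_one_dim_kernel:
  fixes e :: "3 \<Rightarrow> 'a"
  assumes bij: "bij (comb scale e)"
    and mem: "\<And>x y. bracket x y \<in> span (e ` {3})"
    and ab: "\<And>x y. x \<in> span (e ` {3}) \<Longrightarrow> y \<in> span (e ` {3}) \<Longrightarrow> bracket x y = 0"
  shows "(\<exists>\<Lambda>1 \<Lambda>2. \<Lambda>1 \<noteq> 0 \<and> leibniz_isomorphic scale bracket (*s) (k3_1 \<Lambda>1 \<Lambda>2))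
    \<or> (\<exists>\<Lambda>2. \<Lambda>2 \<noteq> 0 \<and> leibniz_isomorphic scale bracket (*s) (k3_2 \<Lambda>2))
    \<or> (\<exists>a b c d. leibniz_isomorphic scale bracket (*s) (k3_3 a b c d))
    \<or> (\<exists>lam2. lam2 \<noteq> 0 \<and> leibniz_isomorphic scale bracket (*s) (k3_4 lam2))
    \<or> (\<exists>lam1. lam1 \<noteq> 0 \<and> leibniz_isomorphic scale bracket (*s) (k3_5 lam1))
    \<or> (\<exists>lam1 lam2. lam1 \<noteq> 0 \<and> lam2 \<noteq> 0 \<and> leibniz_isomorphic scale bracket (*s) (k3_6 lam1 lam2))"
proof -
  have "\<exists>a. x = scale a (e 3)" if "x \<in> span (e ` {3})" for x
    using that by (auto simp: span_breakdown_eq algebra_simps)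
  then have "\<forall>i j. \<exists>a. bracket (e i) (e j) = scale a (e 3)"
    using mem by simp
  then obtain t where t: "bracket (e i) (e j) = scale (t i j) (e 3)" for i j
    by metis
  have "e 3 \<noteq> 0"
  proof
    assume "e 3 = 0"
    then have "comb scale e (axis 3 1) = comb scale e 0"
      by (simp add: comb_axis comb_zero)
    then have "axis 3 1 = (0 :: 'k ^ 3)"
      using bij by (simp add: bij_is_inj inj_eq)
    then show False
      by (simp add: axis_eq_0_iff)
  qed
  then have t33: "t 3 3 = 0"
    using t[of 3 3] ab[of "e 3" "e 3"] span_base[of "e 3"] by simp
  have leib: "t j k * t i 3 = t i j * t 3 k - t i k * t 3 j" for i j k
  proof -
    have "scale (t j k * t i 3) (e 3) = scale (t i j * t 3 k - t i k * t 3 j) (e 3)"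
      using leibniz_identity[of "e i" "e j" "e k"]
      by (simp add: t bracket_simps scale_left_diff_distrib)
    then show ?thesis
      using \<open>e 3 \<noteq> 0\<close> by (simp add: scale_cancel_right)
  qed
  \<comment> \<open>These are the structure constants in the basis \<open>e i + s i * e 3\<close>;
    the term in \<open>s i * s j\<close> is absent because \<open>t 3 3 = 0\<close>. The condition
    \<open>s 3 = 0\<close> keeps \<open>e 3\<close> fixed.\<close>
  have iso: "leibniz_isomorphic scale bracket (*s) (bracket_of_table c)"
    if "s 3 = 0" and "\<And>i j. c (i, j) = (t i j + s j * t i 3 + s i * t 3 j) *s basis3 3" for s c
  proof (rule isomorphic_bracket_of_table)
    show "bij (comb scale (\<lambda>i. e i + scale (s i) (e 3)))"
      using bij that(1) by (rule bij_comb_shear)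
    show "bracket (e i + scale (s i) (e 3)) (e j + scale (s j) (e 3)) =
        comb scale (\<lambda>i. e i + scale (s i) (e 3)) (c (i, j))" for i j
      using that by (simp add: t t33 bracket_simps comb_scale comb_axis) (simp add: algebra_simps)
  qed
  show ?thesis
  proof (cases "t 1 3 = 0 \<and> t 2 3 = 0")
    case True
    show ?thesis
    proof (cases "t 3 1 = 0 \<and> t 3 2 = 0")
      case True
      have "leibniz_isomorphic scale bracket (*s) (k3_3 (t 1 1) (t 1 2) (t 2 1) (t 2 2))"
        unfolding k3_3_def
      proof (rule iso[of "\<lambda>_. 0"])
        show "((\<lambda>_. 0)(
            (1, 1) := t 1 1 *s basis3 3, (1, 2) := t 1 2 *s basis3 3,
            (2, 1) := t 2 1 *s basis3 3, (2, 2) := t 2 2 *s basis3 3)) (i, j) =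
            (t i j + 0 * t i 3 + 0 * t 3 j) *s basis3 3" for i j
          using exhaust_3[of i] exhaust_3[of j] True \<open>t 1 3 = 0 \<and> t 2 3 = 0\<close>
          by (auto simp: t33)
      qed simp
      then show ?thesis by blast
    next
      case False
      then obtain m where m: "t 3 m \<noteq> 0"
        by blast
      have ti3: "t i 3 = 0" for i
        using True t33 exhaust_3[of i] by auto
      \<comment> \<open>Chosen to annihilate the entries \<open>t i m\<close>. The Leibniz identity
        reduces to \<open>t i j * t 3 m = t i m * t 3 j\<close>, so row \<open>i\<close> is
        proportional to row 3 and the same shear annihilates all of it.\<close>
      define s where "s i = (if i = 3 then 0 else - t i m / t 3 m)" for i
      have killed: "t i j + s i * t 3 j = 0" if "i \<noteq> 3" for i j
        using leib[of j m i] m that by (simp add: ti3 s_def field_simps)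
      have c: "leibniz_isomorphic scale bracket (*s) (bracket_of_table c)"
        if "\<And>i j. c (i, j) = (if i = 3 then t 3 j else 0) *s basis3 3" for c
      proof (rule iso[of s])
        show "c (i, j) = (t i j + s j * t i 3 + s i * t 3 j) *s basis3 3" for i j
          using killed[of i j] by (cases "i = 3") (simp_all add: that ti3 s_def)
      qed (simp add: s_def)
      consider "t 3 1 = 0" "t 3 2 \<noteq> 0" | "t 3 1 \<noteq> 0" "t 3 2 = 0" | "t 3 1 \<noteq> 0" "t 3 2 \<noteq> 0"
        using False by blast
      then show ?thesis
      proof cases
        case 1
        have "leibniz_isomorphic scale bracket (*s) (k3_4 (t 3 2))"
          unfolding k3_4_def
        proof (rule c)
          show "((\<lambda>_. 0)((3, 2) := t 3 2 *s basis3 3)) (i, j) =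
              (if i = 3 then t 3 j else 0) *s basis3 3" for i j :: 3
            using 1 t33 exhaust_3[of i] exhaust_3[of j] by auto
        qed
        then show ?thesis using 1 by blast
      next
        case 2
        have "leibniz_isomorphic scale bracket (*s) (k3_5 (t 3 1))"
          unfolding k3_5_def
        proof (rule c)
          show "((\<lambda>_. 0)((3, 1) := t 3 1 *s basis3 3)) (i, j) =
              (if i = 3 then t 3 j else 0) *s basis3 3" for i j :: 3
            using 2 t33 exhaust_3[of i] exhaust_3[of j] by auto
        qed
        then show ?thesis using 2 by blast
      next
        case 3
        have "leibniz_isomorphic scale bracket (*s) (k3_6 (t 3 1) (t 3 2))"
          unfolding k3_6_def
        proof (rule c)
          show "((\<lambda>_. 0)((3, 1) := t 3 1 *s basis3 3, (3, 2) := t 3 2 *s basis3 3)) (i, j) =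
              (if i = 3 then t 3 j else 0) *s basis3 3" for i j :: 3
            using t33 exhaust_3[of i] exhaust_3[of j] by auto
        qed
        then show ?thesis using 3 by blast
      qed
    qed
  next
    case False
    then obtain m where m: "t m 3 \<noteq> 0"
      by blast
    have t3: "t 3 j = - t j 3" for j
    proof -
      have "t m 3 * (t j 3 + t 3 j) = 0"
        using leib[of j 3 m] by (simp add: t33 algebra_simps)
      then show ?thesis
        using m by (simp add: eq_neg_iff_add_eq_0 add.commute)
    qed
    \<comment> \<open>Derived directly, since in characteristic 2 it would not follow from
      antisymmetry.\<close>
    have tii: "t i i = 0" for i
      using leib[of i m i] m by (simp add: t3)
    have "t j m = - t m j" for j
    proof -
      have "t m 3 * (t j m + t m j) = 0"
        using leib[of j m m] by (simp add: t3 tii algebra_simps)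
      then show ?thesis
        using m by (simp add: eq_neg_iff_add_eq_0)
    qed
    \<comment> \<open>Since \<open>t 3 3 = 0\<close>, the index \<open>m\<close> is 1 or 2, and
      \<open>j\<close> is taken to be the other one.\<close>
    then have t21: "t 2 1 = - t 1 2"
      using m t33 exhaust_3[of m] by (metis minus_minus)
    \<comment> \<open>The sheared table is antisymmetric with zero diagonal, so among the indices 1
      and 2 only the entry at (1, 2) has to be annihilated. This is one linear equation in
      \<open>s 1\<close> and \<open>s 2\<close>, solvable because \<open>t 1 3\<close> or
      \<open>t 2 3\<close> is nonzero.\<close>
    obtain s :: "3 \<Rightarrow> 'k" where s: "s 3 = 0" "t 1 2 + s 2 * t 1 3 - s 1 * t 2 3 = 0"
    proof (cases "t 1 3 = 0")
      case True
      then show thesis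
        using False that[of "\<lambda>i. if i = 1 then t 1 2 / t 2 3 else 0"] by simp
    next
      case False
      then show thesis
        using that[of "\<lambda>i. if i = 2 then - t 1 2 / t 1 3 else 0"] by simp
    qed
    have s': "t 2 1 + s 1 * t 2 3 - s 2 * t 1 3 = 0"
      using s(2) t21 by (simp add: algebra_simps)
    show ?thesis
    proof (cases "t 1 3 = 0")
      case True
      have "leibniz_isomorphic scale bracket (*s) (k3_2 (t 2 3))"
        unfolding k3_2_def
      proof (rule iso[of s, OF s(1)])
        show "((\<lambda>_. 0)((2, 3) := t 2 3 *s basis3 3, (3, 2) := - (t 2 3 *s basis3 3))) (i, j) =
            (t i j + s j * t i 3 + s i * t 3 j) *s basis3 3" for i j
          using exhaust_3[of i] exhaust_3[of j] s s' True by (auto simp: t3[of 1] t3[of 2] t33 tii)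
      qed
      then show ?thesis using False True by blast
    next
      case neq: False
      have "leibniz_isomorphic scale bracket (*s) (k3_1 (t 1 3) (t 2 3))"
        unfolding k3_1_def
      proof (rule iso[of s, OF s(1)])
        show "((\<lambda>_. 0)(
            (1, 3) := t 1 3 *s basis3 3, (3, 1) := - (t 1 3 *s basis3 3),
            (2, 3) := t 2 3 *s basis3 3, (3, 2) := - (t 2 3 *s basis3 3))) (i, j) =
            (t i j + s j * t i 3 + s i * t 3 j) *s basis3 3" for i j
          using exhaust_3[of i] exhaust_3[of j] s s' by (auto simp: t3[of 1] t3[of 2] t33 tii)
      qed
      then show ?thesis using neq by blast
    qed
  qed
qed

end

section \<open>Case distinction on the dimension of the kernel\<close>

theorem corollary3p11:
  fixes scale :: "'k::field \<Rightarrow> 'a::ab_group_add \<Rightarrow> 'a"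
    and bracket :: "'a \<Rightarrow> 'a \<Rightarrow> 'a"
  assumes "leibniz_algebra scale bracket"
    and "vector_space.dim scale (UNIV :: 'a set) = 3"
    and "metabelian TYPE('g::ab_group_add) TYPE('l::ab_group_add) scale bracket"
  shows "leibniz_isomorphic scale bracket (*s) k3_0
    \<or> (\<exists>A B \<gamma>. (A, B, \<gamma>) \<in> T2 \<and> leibniz_isomorphic scale bracket (*s) (k3_mat A B \<gamma>))
    \<or> (\<exists>\<Lambda>1 \<Lambda>2. \<Lambda>1 \<noteq> 0 \<and> leibniz_isomorphic scale bracket (*s) (k3_1 \<Lambda>1 \<Lambda>2))
    \<or> (\<exists>\<Lambda>2. \<Lambda>2 \<noteq> 0 \<and> leibniz_isomorphic scale bracket (*s) (k3_2 \<Lambda>2))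
    \<or> (\<exists>a b c d. leibniz_isomorphic scale bracket (*s) (k3_3 a b c d))
    \<or> (\<exists>lam2. lam2 \<noteq> 0 \<and> leibniz_isomorphic scale bracket (*s) (k3_4 lam2))
    \<or> (\<exists>lam1. lam1 \<noteq> 0 \<and> leibniz_isomorphic scale bracket (*s) (k3_5 lam1))
    \<or> (\<exists>lam1 lam2. lam1 \<noteq> 0 \<and> lam2 \<noteq> 0 \<and> leibniz_isomorphic scale bracket (*s) (k3_6 lam1 lam2))"
proof -
  interpret leibniz_algebra scale bracket by fact
  obtain N where N: "subspace N" "\<And>x y. bracket x y \<in> N"
      "\<And>x y. x \<in> N \<Longrightarrow> y \<in> N \<Longrightarrow> bracket x y = 0"
    using metabelian_subspace[OF assms(3)] by metis
  \<comment> \<open>The sets \<open>{3}\<close> and \<open>{1, 2}\<close> used for \<open>I\<close>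
    below match the positions of the kernel in the tables of the families.\<close>
  have adapted: "\<exists>e :: 3 \<Rightarrow> 'a. bij (comb scale e) \<and> span (e ` I) = N"
    if "card I = dim N" for I :: "3 set"
    using adapted_basis[OF N(1), of I] that assms(2) by auto
  have "dim N \<le> 3"
    using dim_le_of_subspace[OF N(1)] assms(2) by simp
  then consider "dim N = 0" | "dim N = 1" | "dim N = 2" | "dim N = 3"
    by linarith
  then show ?thesis
  proof cases
    case 1
    then obtain e :: "3 \<Rightarrow> 'a" where e: "bij (comb scale e)" "span (e ` {}) = N"
      using adapted[of "{}"] by auto
    have "bracket x y = 0" for x y
      using N(2)[of x y] e(2) by auto
    then show ?thesis
      using isomorphic_k3_0[OF e(1)] by blast
  next
    case 2
    then obtain e :: "3 \<Rightarrow> 'a" where e: "bij (comb scale e)" "span (e ` {3}) = N"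
      using adapted[of "{3}"] by auto
    then show ?thesis
      using isomorphic_one_dim_kernel[OF e(1), unfolded e(2), OF N(2,3)] by simp
  next
    case 3
    then obtain e :: "3 \<Rightarrow> 'a" where e: "bij (comb scale e)" "span (e ` {1, 2}) = N"
      using adapted[of "{1, 2}"] by auto
    then show ?thesis
      using isomorphic_two_dim_kernel[OF e(1), unfolded e(2), OF N(2,3)] by simp
  next
    case 4
    then obtain e :: "3 \<Rightarrow> 'a" where e: "bij (comb scale e)" "span (e ` UNIV) = N"
      using adapted[of UNIV] by auto
    \<comment> \<open>Here \<open>N\<close> is the whole space, so the vanishing of the bracket on
      \<open>N\<close> is its vanishing everywhere.\<close>
    have "x \<in> N" for x
      using comb_in_span bij_is_surj[OF e(1)] e(2) by (metis surjD)
    then have "bracket x y = 0" for x y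
      using N(3) by blast
    then show ?thesis
      using isomorphic_k3_0[OF e(1)] by simp
  qed
qed

end
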